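(* Let $H\in\mathbb{R}^{n\times n}$ be symmetric, $c\in\mathbb{R}^n$, $\sigma>0$, $p>2$, and let $g(x)=\frac12x^THx+c^Tx+\frac{\sigma}{p}\|x\|^p$. Let $\alpha_1\le\dots\le\alpha_n$ be the eigenvalues of $H$ and let $k$ be the multiplicity of the smallest eigenvalue, i.e. $\alpha_1=\dots=\alpha_k<\alpha_{k+1}\le\dots\le\alpha_n$. Let all vectors be expressed in coordinates with respect to an orthonormal basis of eigenvectors of $H$ ordered accordingly, so that in these coordinates $H=\mathrm{Diag}(\alpha_1,\dots,\alpha_n)$ and $c=(c_1,\dots,c_n)$. Then the set of global minimizers of $g$ over $\mathbb{R}^n$ is either a singleton or a $k$-dimensional sphere centered at $$\left(0,\dots,0,-\frac{c_{k+1}}{\alpha_{k+1}-\alpha_1},\dots,-\frac{c_n}{\alpha_n-\alpha_1}\right)$$ with radius $$\sqrt{\left(\frac{-\alpha_1}{\sigma}\right)^{\frac{2}{p-2}}-\sum_{i=k+1}^n\frac{c_i^2}{(\alpha_i-\alpha_1)^2}}$$ (in the second case $\alpha_1\le 0$ and the quantity under the square root is nonnegative).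
   Context: $\|\cdot\|$ is the Euclidean norm. The problem $\min_{x\in\mathbb{R}^n}g(x)$ is the $p$-regularized subproblem (p-RS). Here a "$k$-dimensional sphere" with center $z=(0,\dots,0,z_{k+1},\dots,z_n)$ and radius $r\ge 0$ means the set $\{x\in\mathbb{R}^n : x_1^2+\dots+x_k^2=r^2,\ x_i=z_i \text{ for } i=k+1,\dots,n\}$, i.e. a sphere in the $k$-dimensional affine subspace given by the first $k$ coordinates. If $k=n$ the sum over $i$ is empty. *)

theory Defs
  imports "HOL-Analysis.Analysis"
begin

definition p_RS_objective ::
  "real^'n^'n \<Rightarrow> real^'n \<Rightarrow> real \<Rightarrow> real \<Rightarrow> real^'n \<Rightarrow> real" where
  "p_RS_objective H c \<sigma> p x =
     1/2 * (x \<bullet> (H *v x)) + c \<bullet> x + \<sigma> / p * norm x powr p"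

definition global_minimizers :: "('a \<Rightarrow> real) \<Rightarrow> 'a set" where
  "global_minimizers f = {x. \<forall>y. f x \<le> f y}"

text \<open>
  An orthonormal eigenbasis is a family indexed by \<open>{1..n}\<close>, where \<open>n = CARD('n)\<close>; eigenvalues
  are listed in nondecreasing order, with multiplicity. The number \<open>n\<close> of orthonormal vectors
  makes the family a basis. The values of \<open>v\<close> and \<open>\<alpha>\<close> outside \<open>{1..n}\<close> are irrelevant.
\<close>

definition ordered_orthonormal_eigenbasis ::
  "real^'n^'n \<Rightarrow> (nat \<Rightarrow> real) \<Rightarrow> (nat \<Rightarrow> real^'n) \<Rightarrow> bool" where
  "ordered_orthonormal_eigenbasis H \<alpha> v \<longleftrightarrow>
     mono_on {1..CARD('n)} \<alpha> \<and>
     (\<forall>i\<in>{1..CARD('n)}. \<forall>j\<in>{1..CARD('n)}. v i \<bullet> v j = (if i = j then 1 else 0)) \<and>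
     (\<forall>i\<in>{1..CARD('n)}. H *v v i = \<alpha> i *\<^sub>R v i)"

text \<open>
  The \<open>i\<close>-th coordinate of \<open>x\<close> with respect to an orthonormal basis \<open>v\<close> is \<open>v i \<bullet> x\<close>. The centre
  \<open>z\<close> is given by its coordinates, of which the first \<open>k\<close> are meant to be zero.
\<close>

definition k_sphere ::
  "(nat \<Rightarrow> real^'n) \<Rightarrow> nat \<Rightarrow> (nat \<Rightarrow> real) \<Rightarrow> real \<Rightarrow> (real^'n) set" where
  "k_sphere v k z r =
     {x. (\<Sum>i=1..k. (v i \<bullet> x)\<^sup>2) = r\<^sup>2 \<and> (\<forall>i\<in>{k+1..CARD('n)}. v i \<bullet> x = z i)}"

end

theory Submission
  imports Defs "HOL-Real_Asymp.Real_Asymp"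
begin

text \<open>
  Put \<open>\<lambda> = \<sigma> \<parallel>x\<parallel>\<^sup>p\<^sup>-\<^sup>2\<close>. A global minimizer \<open>x\<close> satisfies \<open>H x + c + \<lambda> x = 0\<close>, and comparing
  \<open>x\<close> with points of the same norm shows that \<open>H + \<lambda> I\<close> is positive semidefinite. Then
  \<open>g y - g x\<close> is the sum of half the quadratic form of \<open>H + \<lambda> I\<close> at \<open>y - x\<close> and of the gap in
  the tangent inequality of the strictly convex function \<open>t \<mapsto> t\<^sup>p\<^sup>/\<^sup>2\<close> between \<open>\<parallel>x\<parallel>\<^sup>2\<close> and
  \<open>\<parallel>y\<parallel>\<^sup>2\<close>. Hence \<open>y\<close> is a minimizer exactly when \<open>\<parallel>y\<parallel> = \<parallel>x\<parallel>\<close> and \<open>y - x\<close> is in the kernel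
  of \<open>H + \<lambda> I\<close>. The kernel is trivial if \<open>\<alpha>\<^sub>1 + \<lambda> > 0\<close>, and the eigenspace of \<open>\<alpha>\<^sub>1\<close> if
  \<open>\<alpha>\<^sub>1 + \<lambda> = 0\<close>.
\<close>

text \<open>By the mean value theorem the chord has slope \<open>q * z powr (q - 1)\<close> at some
  \<open>z\<close> strictly between \<open>s\<close> and \<open>t\<close>, and this slope is
  strictly increasing in \<open>z\<close>. The derivative rule needs a positive base, so arguments
  equal to 0 are treated separately; for \<open>t = 0\<close> the gap is
  \<open>(q - 1) * s powr q\<close>.\<close>

lemma powr_tangent_less:
  fixes q s t :: real
  assumes q: "q > 1" and s: "s \<ge> 0" and t: "t \<ge> 0" and "s \<noteq> t"
  shows "s powr q + q * s powr (q - 1) * (t - s) < t powr q"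
proof (cases "s = 0 \<or> t = 0")
  case True
  show ?thesis
  proof (cases "s = 0")
    case True
    then show ?thesis using assms by simp
  next
    case False
    with True have "t = 0" "s > 0" using s by auto
    moreover have "s powr q = s powr (q - 1) * s"
      using \<open>s > 0\<close> powr_mult_base[of s "q - 1"] by (simp add: mult.commute)
    moreover have "s powr (q - 1) * s * (q - 1) > 0"
      using \<open>s > 0\<close> q by simp
    ultimately show ?thesis using q by (simp add: algebra_simps)
  qed
next
  case False
  then have pos: "s > 0" "t > 0" using s t by auto
  have der: "((\<lambda>u. u powr q) has_real_derivative q * u powr (q - 1)) (at u)" if "u > 0" for u
    using that by (rule has_real_derivative_powr)
  consider "s < t" | "t < s" using \<open>s \<noteq> t\<close> by linarith
  then show ?thesis
  proof cases
    case 1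
    then obtain z where z: "s < z" "z < t" "t powr q - s powr q = (t - s) * (q * z powr (q - 1))"
      using MVT2[of s t "\<lambda>u. u powr q" "\<lambda>u. q * u powr (q - 1)"] der pos by force
    have "s powr (q - 1) < z powr (q - 1)"
      using z pos q by (intro powr_less_mono2) auto
    then have "(t - s) * (q * s powr (q - 1)) < (t - s) * (q * z powr (q - 1))"
      using 1 q by simp
    then show ?thesis using z(3) by (simp add: algebra_simps)
  next
    case 2
    then obtain z where z: "t < z" "z < s" "s powr q - t powr q = (s - t) * (q * z powr (q - 1))"
      using MVT2[of t s "\<lambda>u. u powr q" "\<lambda>u. q * u powr (q - 1)"] der pos by force
    have "z powr (q - 1) < s powr (q - 1)"
      using z pos q by (intro powr_less_mono2) auto
    then have "(s - t) * (q * z powr (q - 1)) < (s - t) * (q * s powr (q - 1))"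
      using 2 q by simp
    then show ?thesis using z(3) by (simp add: algebra_simps)
  qed
qed

text \<open>Makes the squared norm the variable: it is polynomial along lines, and the exponent
  \<open>p / 2\<close> exceeds 1 when \<open>p > 2\<close>.\<close>

lemma norm_powr_eq_inner_powr:
  fixes x :: "'a::real_inner"
  shows "norm x powr p = (x \<bullet> x) powr (p / 2)"
proof -
  have "(x \<bullet> x) powr (p / 2) = (norm x powr 2) powr (p / 2)"
    by (cases "x = 0") (simp_all add: dot_square_norm)
  then show ?thesis by (simp only: powr_powr) simp
qed

lemma inner_matrix_commute:
  fixes H :: "real^'n^'n"
  assumes "transpose H = H"
  shows "x \<bullet> (H *v y) = y \<bullet> (H *v x)"
  by (metis assms dot_lmul_matrix inner_commute transpose_matrix_vector)

text \<open>Coercivity: since \<open>p > 2\<close>, the regularization term dominates the quadratic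
  and linear terms for large norm. So the objective is positive outside some ball, while a minimum
  over the ball exists by compactness.\<close>

lemma p_RS_global_minimizer_exists:
  fixes H :: "real^'n^'n"
  assumes "\<sigma> > 0" "p > 2"
  shows "\<exists>x. x \<in> global_minimizers (p_RS_objective H c \<sigma> p)"
proof -
  let ?g = "p_RS_objective H c \<sigma> p"
  define M where "M = onorm ((*v) H)"
  have M: "norm (H *v x) \<le> M * norm x" for x
    unfolding M_def by (rule onorm) (simp add: matrix_vector_mul_bounded_linear)
  have low: "?g x \<ge> - M / 2 * (norm x)\<^sup>2 - norm c * norm x + \<sigma> / p * norm x powr p" for x
  proof -
    have "\<bar>x \<bullet> (H *v x)\<bar> \<le> norm x * (M * norm x)"
      by (rule order_trans[OF Cauchy_Schwarz_ineq2]) (simp add: M mult_left_mono)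
    moreover have "\<bar>c \<bullet> x\<bar> \<le> norm c * norm x" by (rule Cauchy_Schwarz_ineq2)
    ultimately show ?thesis unfolding p_RS_objective_def power2_eq_square by (simp add: algebra_simps)
  qed
  have "\<sigma> / p > 0" using assms by simp
  then have "eventually (\<lambda>t. - M / 2 * t\<^sup>2 - norm c * t + \<sigma> / p * t powr p > 0) at_top"
    using \<open>p > 2\<close> by real_asymp
  then obtain R where R: "\<And>t. t \<ge> R \<Longrightarrow> - M / 2 * t\<^sup>2 - norm c * t + \<sigma> / p * t powr p > 0"
    by (auto simp: eventually_at_top_linorder)
  \<comment> \<open>The bound \<open>R\<close> may be negative; \<open>max R 0\<close> keeps the
    origin in the ball, and the value 0 there is what points outside are compared with.\<close>
  have "continuous_on (cball 0 (max R 0)) ?g"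
    unfolding p_RS_objective_def using \<open>p > 2\<close>
    by (intro continuous_intros continuous_on_powr' matrix_vector_mult_linear_continuous_on) auto
  then obtain x where x: "\<And>y. y \<in> cball 0 (max R 0) \<Longrightarrow> ?g x \<le> ?g y"
    using continuous_attains_inf[of "cball 0 (max R 0)" ?g] by fastforce
  have "?g x \<le> ?g y" for y
  proof (cases "norm y \<le> max R 0")
    case True then show ?thesis using x by simp
  next
    case False
    then have "?g y > 0" using low[of y] R[of "norm y"] by linarith
    moreover have "?g x \<le> ?g 0" by (rule x) simp
    ultimately show ?thesis by (simp add: p_RS_objective_def)
  qed
  then show ?thesis unfolding global_minimizers_def by blast
qed

text \<open>Parseval's identity: orthonormal vectors are independent, and their number equals the
  dimension, so they span.\<close>

lemma ordered_orthonormal_eigenbasis_expand: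
  fixes H :: "real^'n^'n"
  assumes "ordered_orthonormal_eigenbasis H \<alpha> v"
  shows "x \<bullet> y = (\<Sum>i=1..CARD('n). (v i \<bullet> x) * (v i \<bullet> y))"
proof -
  let ?I = "{1..CARD('n)}"
  have orth: "v i \<bullet> v j = (if i = j then 1 else 0)" if "i \<in> ?I" "j \<in> ?I" for i j
    using assms that unfolding ordered_orthonormal_eigenbasis_def by blast
  \<comment> \<open>Injectivity gives the image its full cardinality and turns the sum over basis
    vectors into a sum over indices.\<close>
  have inj: "inj_on v ?I"
    by (rule inj_onI) (metis orth zero_neq_one)
  have "pairwise orthogonal (v ` ?I)"
    unfolding pairwise_def orthogonal_def using orth by auto
  moreover have "0 \<notin> v ` ?I" using orth by force
  ultimately have "independent (v ` ?I)"
    by (rule pairwise_orthogonal_independent)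
  then have "span (v ` ?I) = UNIV"
    using card_eq_dim[of "v ` ?I" UNIV] card_image[OF inj]
    by (auto simp: independent_imp_finite)
  moreover have "norm b = 1" if "b \<in> v ` ?I" for b
    using that orth by (auto simp: norm_eq_1)
  ultimately have "(\<Sum>b\<in>v ` ?I. (x \<bullet> b) *\<^sub>R b) = x"
    using \<open>pairwise orthogonal (v ` ?I)\<close> by (intro orthonormal_basis_expand) auto
  moreover have "(\<Sum>b\<in>v ` ?I. (x \<bullet> b) *\<^sub>R b) = (\<Sum>i\<in>?I. (x \<bullet> v i) *\<^sub>R v i)"
    by (rule sum.reindex[OF inj, unfolded o_def])
  ultimately have "x = (\<Sum>i\<in>?I. (x \<bullet> v i) *\<^sub>R v i)"
    by metis
  then have "x \<bullet> y = (\<Sum>i\<in>?I. (x \<bullet> v i) *\<^sub>R v i) \<bullet> y" by (rule arg_cong)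
  then show ?thesis by (simp add: inner_sum_left inner_commute[of x])
qed

text \<open>Stationarity eliminates \<open>c\<close>, and completing the square leaves a quadratic
  form in \<open>y - x\<close>. The remaining bracket depends only on the two norms, and vanishes
  when they agree.\<close>

lemma p_RS_objective_diff:
  fixes H :: "real^'n^'n" and x y :: "real^'n"
  assumes "transpose H = H" and stat: "H *v x + c + l *\<^sub>R x = 0"
  shows "p_RS_objective H c \<sigma> p y - p_RS_objective H c \<sigma> p x =
     ((y - x) \<bullet> (H *v (y - x)) + l * ((y - x) \<bullet> (y - x))) / 2
     + (\<sigma> / p * (y \<bullet> y) powr (p / 2) - \<sigma> / p * (x \<bullet> x) powr (p / 2)
        - l / 2 * (y \<bullet> y - x \<bullet> x))"
proof -
  have c: "c = - (H *v x) - l *\<^sub>R x"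
    using stat by (simp add: algebra_simps eq_neg_iff_add_eq_0)
  show ?thesis
    unfolding p_RS_objective_def norm_powr_eq_inner_powr c
    using inner_matrix_commute[OF assms(1), of x y]
    by (simp add: inner_diff_left inner_diff_right matrix_vector_mult_diff_distrib
        inner_commute[of "H *v x"] inner_commute[of y x] field_simps)
qed

text \<open>The direction of differentiation is the candidate gradient \<open>w\<close> itself: the
  derivative at 0 is then \<open>w \<bullet> w\<close>, which must vanish at a minimum.\<close>

lemma p_RS_global_minimizer_stationary:
  fixes H :: "real^'n^'n"
  assumes sym: "transpose H = H" and "p > 2"
    and min: "x \<in> global_minimizers (p_RS_objective H c \<sigma> p)"
  shows "H *v x + c + (\<sigma> * (x \<bullet> x) powr (p / 2 - 1)) *\<^sub>R x = 0"
proof -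
  define w where "w = H *v x + c + (\<sigma> * (x \<bullet> x) powr (p / 2 - 1)) *\<^sub>R x"
  let ?f = "\<lambda>t. p_RS_objective H c \<sigma> p (x + t *\<^sub>R w)"
  let ?h = "\<lambda>t. x \<bullet> (H *v x) / 2 + c \<bullet> x + t * (w \<bullet> (H *v x) + c \<bullet> w) + t\<^sup>2 / 2 * (w \<bullet> (H *v w))"
  have f: "?f t = ?h t + \<sigma> / p * norm (x + t *\<^sub>R w) powr p" for t
    unfolding p_RS_objective_def using inner_matrix_commute[OF sym, of x w]
    by (simp add: inner_add_left inner_add_right matrix_vector_right_distrib
        matrix_vector_mult_scaleR power2_eq_square field_simps)
  have h: "(?h has_real_derivative w \<bullet> (H *v x) + c \<bullet> w) (at 0)"
    by (auto intro!: derivative_eq_intros)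
  have "((\<lambda>t. norm (x + t *\<^sub>R w) powr p) has_real_derivative
           p * (x \<bullet> x) powr (p / 2 - 1) * (x \<bullet> w)) (at 0)"
  proof (cases "x = 0")
    case True
    have "((\<lambda>t. \<bar>t\<bar> powr (p - 1) * norm w powr p) \<longlongrightarrow> 0) (at 0)"
      using \<open>p > 2\<close> by (auto intro!: tendsto_eq_intros)
    then have "((\<lambda>t. norm (t *\<^sub>R w) powr p / t) \<longlongrightarrow> 0) (at 0)"
    proof (rule Lim_null_comparison[rotated], intro always_eventually allI)
      fix t :: real
      show "norm (norm (t *\<^sub>R w) powr p / t) \<le> \<bar>t\<bar> powr (p - 1) * norm w powr p"
        using \<open>p > 2\<close> by (simp add: powr_mult powr_diff abs_mult)
    qed
    then show ?thesis using True by (simp add: DERIV_def)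
  next
    case False
    have "((\<lambda>t. (x \<bullet> x + t * (2 * (x \<bullet> w)) + t\<^sup>2 * (w \<bullet> w)) powr (p / 2)) has_real_derivative
           p * (x \<bullet> x) powr (p / 2 - 1) * (x \<bullet> w)) (at 0)"
      using False by (auto intro!: derivative_eq_intros)
    moreover have "x \<bullet> x + t * (2 * (x \<bullet> w)) + t\<^sup>2 * (w \<bullet> w) = (x + t *\<^sub>R w) \<bullet> (x + t *\<^sub>R w)" for t
      by (simp add: inner_add_left inner_add_right inner_commute power2_eq_square algebra_simps)
    ultimately show ?thesis by (simp add: norm_powr_eq_inner_powr)
  qed
  then have "((\<lambda>t. ?h t + \<sigma> / p * norm (x + t *\<^sub>R w) powr p) has_real_derivative
     (w \<bullet> (H *v x) + c \<bullet> w) + \<sigma> / p * (p * (x \<bullet> x) powr (p / 2 - 1) * (x \<bullet> w))) (at 0)"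
    by (intro DERIV_add[OF h] DERIV_cmult)
  moreover have "(w \<bullet> (H *v x) + c \<bullet> w) + \<sigma> / p * (p * (x \<bullet> x) powr (p / 2 - 1) * (x \<bullet> w)) = w \<bullet> w"
  proof -
    have "w \<bullet> w = w \<bullet> (H *v x + c + (\<sigma> * (x \<bullet> x) powr (p / 2 - 1)) *\<^sub>R x)"
      by (simp only: w_def)
    then show ?thesis using \<open>p > 2\<close> by (simp add: inner_add_right inner_commute)
  qed
  ultimately have "(?f has_real_derivative w \<bullet> w) (at 0)"
    unfolding f by simp
  then have "w \<bullet> w = 0"
    by (rule DERIV_local_min[of _ _ _ 1]) (use min in \<open>auto simp: global_minimizers_def\<close>)
  then show ?thesis unfolding w_def by simp
qed

text \<open>On the sphere through \<open>x\<close> only the quadratic part of the objective gap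
  survives, so it is nonnegative along every chord from \<open>x\<close>. Directions orthogonal to
  \<open>x\<close> are reached as limits.\<close>

lemma p_RS_global_minimizer_eigenvalue:
  fixes H :: "real^'n^'n"
  assumes sym: "transpose H = H" and "p > 2"
    and min: "x \<in> global_minimizers (p_RS_objective H c \<sigma> p)"
    and eig: "H *v e = a *\<^sub>R e" and "norm e = 1"
  shows "0 \<le> a + \<sigma> * (x \<bullet> x) powr (p / 2 - 1)"
proof -
  define l where "l = \<sigma> * (x \<bullet> x) powr (p / 2 - 1)"
  have ee: "e \<bullet> e = 1" using \<open>norm e = 1\<close> by (simp add: norm_eq_1)
  have stat: "H *v x + c + l *\<^sub>R x = 0"
    unfolding l_def using sym \<open>p > 2\<close> min by (rule p_RS_global_minimizer_stationary)
  let ?Q = "\<lambda>u. u \<bullet> (H *v u) + l * (u \<bullet> u)"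
  show ?thesis
  proof (cases "x = 0")
    case True
    then have "c = 0" "l = 0" using stat by (auto simp: l_def)
    \<comment> \<open>Small positive multiples of \<open>e\<close> are compared with the minimizer
      0; dividing by \<open>t\<^sup>2\<close> leaves a regularization term that tends to 0 because
      \<open>p > 2\<close>.\<close>
    have "0 \<le> a / 2 + \<sigma> / p * t powr (p - 2)" if "t > 0" for t
    proof -
      have "0 \<le> p_RS_objective H c \<sigma> p (t *\<^sub>R e)"
        using min True unfolding global_minimizers_def
        by (auto simp: p_RS_objective_def dest!: spec[of _ "t *\<^sub>R e"])
      also have "\<dots> = t\<^sup>2 * (a / 2 + \<sigma> / p * t powr (p - 2))"
        using that \<open>norm e = 1\<close>
        by (simp add: p_RS_objective_def \<open>c = 0\<close> matrix_vector_mult_scaleR eig ee powr_diff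
          power2_eq_square field_simps)
      finally show ?thesis using that by (simp add: zero_le_mult_iff)
    qed
    then have "eventually (\<lambda>t. 0 \<le> a / 2 + \<sigma> / p * t powr (p - 2)) (at_right 0)"
      by (auto simp: eventually_at_right_less intro: eventually_at_rightI[of 0 1])
    moreover have "((\<lambda>t. a / 2 + \<sigma> / p * t powr (p - 2)) \<longlongrightarrow> a / 2 + \<sigma> / p * 0) (at_right 0)"
      using \<open>p > 2\<close> by (intro tendsto_intros) real_asymp
    ultimately have "0 \<le> a / 2 + \<sigma> / p * 0"
      by (intro tendsto_lowerbound) auto
    then show ?thesis using \<open>l = 0\<close> unfolding l_def[symmetric] by simp
  next
    case False
    have Q: "0 \<le> ?Q u" if "x \<bullet> u \<noteq> 0" for u
    proof -
      \<comment> \<open>The line through \<open>x\<close> with direction \<open>u\<close> meets the sphere of radius \<open>norm x\<close> once more.\<close>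
      define t where "t = - 2 * (x \<bullet> u) / (u \<bullet> u)"
      have "u \<noteq> 0" using that by auto
      then have "t \<noteq> 0" "t * (u \<bullet> u) = - 2 * (x \<bullet> u)" using that by (auto simp: t_def)
      then have same: "(x + t *\<^sub>R u) \<bullet> (x + t *\<^sub>R u) = x \<bullet> x"
        by (simp add: inner_add_left inner_add_right inner_commute algebra_simps)
      have "p_RS_objective H c \<sigma> p x \<le> p_RS_objective H c \<sigma> p (x + t *\<^sub>R u)"
        using min by (simp add: global_minimizers_def)
      then have "0 \<le> ?Q (t *\<^sub>R u)"
        using p_RS_objective_diff[OF sym stat, of \<sigma> p "x + t *\<^sub>R u"] same by simp
      also have "\<dots> = t\<^sup>2 * ?Q u"
        by (simp add: matrix_vector_mult_scaleR power2_eq_square algebra_simps)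
      finally show ?thesis using \<open>t \<noteq> 0\<close> by (simp add: zero_le_mult_iff)
    qed
    show ?thesis
    proof (cases "x \<bullet> e = 0")
      case False
      then show ?thesis using Q[of e] by (simp add: eig ee l_def)
    next
      case True
      \<comment> \<open>Adding \<open>t *\<^sub>R x\<close> tilts \<open>e\<close> off the tangent
        hyperplane, so \<open>Q\<close> applies; the cross terms vanish because
        \<open>H *v e\<close> is a multiple of \<open>e\<close>, hence orthogonal to
        \<open>x\<close>.\<close>
      have "0 \<le> a + l + t\<^sup>2 * ?Q x" if "t > 0" for t
      proof -
        have "0 \<le> ?Q (e + t *\<^sub>R x)"
          using that \<open>x \<noteq> 0\<close> True by (intro Q) (simp add: inner_add_right)
        also have "\<dots> = a + l + t\<^sup>2 * ?Q x"
          using inner_matrix_commute[OF sym, of e x] True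
          by (simp add: inner_add_left inner_add_right matrix_vector_right_distrib eig ee
            matrix_vector_mult_scaleR power2_eq_square inner_commute[of e x] algebra_simps)
        finally show ?thesis .
      qed
      then have "eventually (\<lambda>t. 0 \<le> a + l + t\<^sup>2 * ?Q x) (at_right 0)"
        by (auto intro: eventually_at_rightI[of 0 1])
      moreover have "((\<lambda>t. a + l + t\<^sup>2 * ?Q x) \<longlongrightarrow> a + l + 0\<^sup>2 * ?Q x) (at_right 0)"
        by (intro tendsto_intros)
      ultimately have "0 \<le> a + l + 0\<^sup>2 * ?Q x"
        by (intro tendsto_lowerbound) auto
      then show ?thesis by (simp add: l_def)
    qed
  qed
qed

text \<open>The gap to the minimum is a sum of two nonnegative terms, so it is zero exactly when
  both are; the second is positive as soon as the norms differ.\<close>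

lemma p_RS_global_minimizers_eq:
  fixes H :: "real^'n^'n"
  assumes sym: "transpose H = H" and "\<sigma> > 0" and "p > 2"
    and min: "x \<in> global_minimizers (p_RS_objective H c \<sigma> p)"
    and psd: "\<And>u. 0 \<le> u \<bullet> (H *v u) + \<sigma> * (x \<bullet> x) powr (p / 2 - 1) * (u \<bullet> u)"
  shows "global_minimizers (p_RS_objective H c \<sigma> p) =
     {y. y \<bullet> y = x \<bullet> x \<and>
         (y - x) \<bullet> (H *v (y - x)) + \<sigma> * (x \<bullet> x) powr (p / 2 - 1) * ((y - x) \<bullet> (y - x)) = 0}"
proof -
  let ?g = "p_RS_objective H c \<sigma> p"
  define l where "l = \<sigma> * (x \<bullet> x) powr (p / 2 - 1)"
  define Q where "Q u = u \<bullet> (H *v u) + l * (u \<bullet> u)" for u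
  define B where "B y = \<sigma> / p * (y \<bullet> y) powr (p / 2) - \<sigma> / p * (x \<bullet> x) powr (p / 2)
        - l / 2 * (y \<bullet> y - x \<bullet> x)" for y :: "real^'n"
  have diff: "?g y - ?g x = Q (y - x) / 2 + B y" for y
    unfolding Q_def B_def l_def
    using p_RS_global_minimizer_stationary[OF sym \<open>p > 2\<close> min]
    by (rule p_RS_objective_diff[OF sym])
  have B: "B y > 0" if "y \<bullet> y \<noteq> x \<bullet> x" for y
  proof -
    \<comment> \<open>Scaled by \<open>\<sigma> / p\<close>, the slope at
      \<open>x \<bullet> x\<close> becomes exactly \<open>l / 2\<close>, the coefficient in
      \<open>B\<close>.\<close>
    have "(x \<bullet> x) powr (p / 2) + p / 2 * (x \<bullet> x) powr (p / 2 - 1) * (y \<bullet> y - x \<bullet> x)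
        < (y \<bullet> y) powr (p / 2)"
      using \<open>p > 2\<close> that by (intro powr_tangent_less) auto
    then have "0 < \<sigma> / p * ((y \<bullet> y) powr (p / 2) -
        ((x \<bullet> x) powr (p / 2) + p / 2 * (x \<bullet> x) powr (p / 2 - 1) * (y \<bullet> y - x \<bullet> x)))"
      using \<open>p > 2\<close> \<open>\<sigma> > 0\<close> by (intro mult_pos_pos) auto
    also have "\<dots> = B y"
      using \<open>p > 2\<close> by (simp add: B_def l_def right_diff_distrib distrib_left)
    finally show ?thesis .
  qed
  have "y \<in> global_minimizers ?g \<longleftrightarrow> ?g y = ?g x" for y
    using min unfolding global_minimizers_def by (auto intro: order_antisym)
  moreover have "?g y = ?g x \<longleftrightarrow> y \<bullet> y = x \<bullet> x \<and> Q (y - x) = 0" for y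
  proof (cases "y \<bullet> y = x \<bullet> x")
    case True
    then show ?thesis using diff[of y] by (auto simp: B_def)
  next
    case False
    moreover have "Q (y - x) \<ge> 0" using psd unfolding Q_def l_def .
    ultimately have "?g y > ?g x" using diff[of y] B[of y] by linarith
    then show ?thesis using False by simp
  qed
  ultimately show ?thesis unfolding Q_def l_def by blast
qed

theorem theorem2:
  fixes H :: "real^'n^'n" and c :: "real^'n" and \<sigma> p :: real
    and \<alpha> :: "nat \<Rightarrow> real" and v :: "nat \<Rightarrow> real^'n" and k :: nat
  assumes "transpose H = H"
    and "\<sigma> > 0" and "p > 2"
    and "ordered_orthonormal_eigenbasis H \<alpha> v"
    and "1 \<le> k" and "k \<le> CARD('n)"
    and "\<forall>i\<in>{1..k}. \<alpha> i = \<alpha> 1"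
    and "k < CARD('n) \<longrightarrow> \<alpha> k < \<alpha> (k + 1)"
  defines "radicand \<equiv> (- \<alpha> 1 / \<sigma>) powr (2 / (p - 2))
             - (\<Sum>i=k+1..CARD('n). (v i \<bullet> c)\<^sup>2 / (\<alpha> i - \<alpha> 1)\<^sup>2)"
  shows "(\<exists>x. global_minimizers (p_RS_objective H c \<sigma> p) = {x}) \<or>
         (\<alpha> 1 \<le> 0 \<and> radicand \<ge> 0 \<and>
          global_minimizers (p_RS_objective H c \<sigma> p) =
            k_sphere v k (\<lambda>i. if i \<le> k then 0 else - (v i \<bullet> c) / (\<alpha> i - \<alpha> 1)) (sqrt radicand))"
proof -
  let ?n = "CARD('n)" and ?G = "global_minimizers (p_RS_objective H c \<sigma> p)"
  note sym = assms(1) and basis = assms(4)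
  have mono: "\<alpha> i \<le> \<alpha> j" if "1 \<le> i" "i \<le> j" "j \<le> ?n" for i j
    using basis that unfolding ordered_orthonormal_eigenbasis_def
    by (simp add: mono_on_def)
  have orth: "v i \<bullet> v j = (if i = j then 1 else 0)" if "i \<in> {1..?n}" "j \<in> {1..?n}" for i j
    using basis that unfolding ordered_orthonormal_eigenbasis_def by blast
  have eig: "H *v v i = \<alpha> i *\<^sub>R v i" if "i \<in> {1..?n}" for i
    using basis that unfolding ordered_orthonormal_eigenbasis_def by blast
  have least: "\<alpha> i = \<alpha> 1" if "1 \<le> i" "i \<le> k" for i
    using that by (intro assms(7)[rule_format]) simp
  have gap: "\<alpha> 1 < \<alpha> i" if "i \<in> {k+1..?n}" for i
  proof -
    have "\<alpha> 1 = \<alpha> k" using least[of k] assms(5) by simp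
    \<comment> \<open>An element of \<open>{k+1..?n}\<close> forces \<open>k < ?n\<close>, so the
      strict gap is available; for \<open>k = ?n\<close> the range is empty.\<close>
    also have "\<dots> < \<alpha> (k + 1)" using assms(8) that by simp
    also have "\<dots> \<le> \<alpha> i" using that by (intro mono) auto
    finally show ?thesis .
  qed
  have vH: "v i \<bullet> (H *v u) = \<alpha> i * (v i \<bullet> u)" if "i \<in> {1..?n}" for i u
    using inner_matrix_commute[OF sym, of "v i" u] eig[OF that] by (simp add: inner_commute)
  note parseval = ordered_orthonormal_eigenbasis_expand[OF basis]
  \<comment> \<open>In eigencoordinates the shifted form is diagonal, so both its sign and its zero
    set can be read off from the coefficients \<open>\<alpha> i + l\<close>.\<close>
  have Qsum: "u \<bullet> (H *v u) + l * (u \<bullet> u) = (\<Sum>i=1..?n. (\<alpha> i + l) * (v i \<bullet> u)\<^sup>2)" for u l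
    unfolding parseval[of u "H *v u"] parseval[of u u] sum_distrib_left sum.distrib[symmetric]
    by (intro sum.cong refl) (simp only: vH, simp add: power2_eq_square algebra_simps)
  have split: "y \<bullet> y = (\<Sum>i=1..k. (v i \<bullet> y)\<^sup>2) + (\<Sum>i=k+1..?n. (v i \<bullet> y)\<^sup>2)" for y
  proof -
    have "{1..?n} = {1..k} \<union> {k+1..?n}" using assms(5,6) by auto
    then show ?thesis
      unfolding parseval[of y y] power2_eq_square
      by (simp only:) (intro sum.union_disjoint, auto)
  qed
  obtain x where x: "x \<in> ?G"
    using p_RS_global_minimizer_exists[OF assms(2,3)] by blast
  define l where "l = \<sigma> * (x \<bullet> x) powr (p / 2 - 1)"
  have stat: "H *v x + c + l *\<^sub>R x = 0"
    unfolding l_def by (rule p_RS_global_minimizer_stationary[OF sym assms(3) x])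
  have n1: "1 \<in> {1..?n}" using assms(5,6) by simp
  have l1: "0 \<le> \<alpha> 1 + l"
    unfolding l_def
    by (rule p_RS_global_minimizer_eigenvalue[OF sym assms(3) x eig[OF n1]])
      (use orth[OF n1 n1] in \<open>simp add: norm_eq_1\<close>)
  have nonneg: "0 \<le> \<alpha> i + l" if "i \<in> {1..?n}" for i
    using l1 mono[of 1 i] that by force
  have psd: "0 \<le> u \<bullet> (H *v u) + l * (u \<bullet> u)" for u
    unfolding Qsum using nonneg by (intro sum_nonneg mult_nonneg_nonneg) auto
  have G: "?G = {y. y \<bullet> y = x \<bullet> x \<and> (y - x) \<bullet> (H *v (y - x)) + l * ((y - x) \<bullet> (y - x)) = 0}"
    using psd unfolding l_def by (intro p_RS_global_minimizers_eq[OF sym assms(2,3) x])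
  have Q0: "u \<bullet> (H *v u) + l * (u \<bullet> u) = 0 \<longleftrightarrow> (\<forall>i\<in>{1..?n}. \<alpha> i + l = 0 \<or> v i \<bullet> u = 0)" for u
    unfolding Qsum using nonneg by (subst sum_nonneg_eq_0_iff) auto
  show ?thesis
  proof (cases "\<alpha> 1 + l = 0")
    case False
    \<comment> \<open>Now every coefficient \<open>\<alpha> i + l\<close> is positive, so the kernel
      is trivial and the minimizer unique.\<close>
    have "y = x" if "y \<in> ?G" for y
    proof -
      have "\<alpha> i + l \<noteq> 0" if "i \<in> {1..?n}" for i
        using False l1 mono[of 1 i] that by force
      then have "\<forall>i\<in>{1..?n}. v i \<bullet> (y - x) = 0"
        using that Q0[of "y - x"] unfolding G by blast
      then have "(y - x) \<bullet> (y - x) = 0" by (simp add: parseval[of "y - x"])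
      then show ?thesis by simp
    qed
    then show ?thesis using x by blast
  next
    case True
    then have l: "l = - \<alpha> 1" by simp
    have "0 \<le> l" unfolding l_def using assms(2) by simp
    \<comment> \<open>The relation between \<open>l\<close> and the norm of \<open>x\<close> is
      inverted: the exponents \<open>p / 2 - 1\<close> and \<open>2 / (p - 2)\<close> are
      reciprocal. This covers \<open>x = 0\<close> too.\<close>
    have "(- \<alpha> 1 / \<sigma>) powr (2 / (p - 2)) = ((x \<bullet> x) powr (p / 2 - 1)) powr (2 / (p - 2))"
      unfolding l[symmetric] l_def using assms(2) by simp
    also have "(p / 2 - 1) * (2 / (p - 2)) = 1" using assms(3) by (simp add: field_simps)
    then have "((x \<bullet> x) powr (p / 2 - 1)) powr (2 / (p - 2)) = x \<bullet> x"
      by (simp add: powr_powr)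
    finally have norm_x: "(- \<alpha> 1 / \<sigma>) powr (2 / (p - 2)) = x \<bullet> x" .
    \<comment> \<open>Projecting the stationarity equation onto \<open>v i\<close> fixes the
      coordinates outside the lowest eigenspace.\<close>
    have coord: "v i \<bullet> x = - (v i \<bullet> c) / (\<alpha> i - \<alpha> 1)" if "i \<in> {k+1..?n}" for i
    proof -
      have "v i \<bullet> (H *v x + c + l *\<^sub>R x) = 0" using stat by simp
      then have "(\<alpha> i - \<alpha> 1) * (v i \<bullet> x) = - (v i \<bullet> c)"
        using that by (simp add: inner_add_right vH l algebra_simps)
      then show ?thesis using gap[OF that] by (simp add: field_simps)
    qed
    have "(\<Sum>i=k+1..?n. (v i \<bullet> c)\<^sup>2 / (\<alpha> i - \<alpha> 1)\<^sup>2) = (\<Sum>i=k+1..?n. (v i \<bullet> x)\<^sup>2)"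
      by (intro sum.cong refl) (simp add: coord power_divide)
    then have rad: "radicand = (\<Sum>i=1..k. (v i \<bullet> x)\<^sup>2)"
      unfolding radicand_def norm_x using split[of x] by simp
    then have "radicand \<ge> 0" by (simp add: sum_nonneg)
    \<comment> \<open>The kernel is the eigenspace of \<open>\<alpha> 1\<close>: exactly the first
      \<open>k\<close> coordinates are free to move.\<close>
    have kernel: "(\<forall>i\<in>{1..?n}. \<alpha> i + l = 0 \<or> v i \<bullet> (y - x) = 0) \<longleftrightarrow>
        (\<forall>i\<in>{k+1..?n}. v i \<bullet> y = v i \<bullet> x)" for y
    proof -
      have "\<alpha> i + l = 0 \<longleftrightarrow> i \<le> k" if "i \<in> {1..?n}" for i
        using that least[of i] gap[of i] unfolding l by (cases "i \<le> k") auto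
      then have "(\<forall>i\<in>{1..?n}. \<alpha> i + l = 0 \<or> v i \<bullet> (y - x) = 0) \<longleftrightarrow>
          (\<forall>i\<in>{1..?n}. k < i \<longrightarrow> v i \<bullet> y = v i \<bullet> x)"
        by (auto simp: inner_diff_right)
      also have "\<dots> \<longleftrightarrow> (\<forall>i\<in>{k+1..?n}. v i \<bullet> y = v i \<bullet> x)"
        by (rule iffI; intro ballI) (simp_all add: Suc_le_eq)
      finally show ?thesis .
    qed
    have "y \<in> ?G \<longleftrightarrow> (\<Sum>i=1..k. (v i \<bullet> y)\<^sup>2) = radicand \<and> (\<forall>i\<in>{k+1..?n}. v i \<bullet> y = v i \<bullet> x)" for y
    proof -
      \<comment> \<open>With the last coordinates shared, their squares cancel from the norm
        condition, leaving the sphere equation in the first \<open>k\<close> coordinates.\<close>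
      have "y \<bullet> y = x \<bullet> x \<longleftrightarrow> (\<Sum>i=1..k. (v i \<bullet> y)\<^sup>2) = radicand"
        if "\<forall>i\<in>{k+1..?n}. v i \<bullet> y = v i \<bullet> x"
        using that unfolding split[of x] split[of y] rad by simp
      then show ?thesis unfolding G mem_Collect_eq Q0 kernel by blast
    qed
    then have "?G = k_sphere v k (\<lambda>i. if i \<le> k then 0 else - (v i \<bullet> c) / (\<alpha> i - \<alpha> 1)) (sqrt radicand)"
      using \<open>radicand \<ge> 0\<close> coord unfolding k_sphere_def by auto
    then show ?thesis using \<open>0 \<le> l\<close> l \<open>radicand \<ge> 0\<close> by simp
  qed
qed

end
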